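(* Let $t,k,v,\lambda$ be positive integers with $k\ge t\ge 2$ and $v\ge 2$. Denote $p=1/v^t$ and $a=\sqrt{\frac{(1-p)^{2\lambda}-p^{2\lambda}}{1-2p}}$. Then \[ \mathsf{CAN}_\lambda(t,k,v)\le \frac{\lambda}{\log(1-p)}\,W_{-1}\!\left(\frac{\log(1-p)}{e\left(\left(\binom{k}{t}-\binom{k-t}{t}\right)v^t a(1-p)e\right)^{1/\lambda}}\right). \]
   Context: A covering array $\mathsf{CA}_\lambda(N;t,k,v)$ is an $N\times k$ array with entries from an alphabet $\Sigma$ of size $v$ such that for every set of $t$ distinct columns and every tuple $x\in\Sigma^t$, the tuple $x$ occurs as a row of the $N\times t$ subarray formed by those columns at least $\lambda$ times. $\mathsf{CAN}_\lambda(t,k,v)$ is the smallest $N$ for which a $\mathsf{CA}_\lambda(N;t,k,v)$ exists. $\log$ is the natural logarithm; $\binom{n}{m}=0$ when $m>n$. $W_{-1}$ is the lower real branch of the Lambert $W$ function: for $-1/e\le x<0$, $W_{-1}(x)$ is the unique real $w\le -1$ with $we^w=x$. *)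

theory Defs
  imports Complex_Main "HOL-Library.FuncSet"
begin

text \<open>An \<open>N \<times> k\<close> array is a function of a row index \<open>i < N\<close> and a column index \<open>j < k\<close>;
  entries outside this range are irrelevant.  A \<open>t\<close>-tuple attached to a \<open>t\<close>-element set \<open>T\<close> of
  columns is indexed by the columns themselves, i.e. it is an element of \<open>T \<rightarrow>\<^sub>E \<Sigma>\<close>.\<close>

definition covering_array ::
  "'a set \<Rightarrow> nat \<Rightarrow> nat \<Rightarrow> nat \<Rightarrow> nat \<Rightarrow> (nat \<Rightarrow> nat \<Rightarrow> 'a) \<Rightarrow> bool" where
  "covering_array \<Sigma> lam N t k A \<longleftrightarrow>
     (\<forall>i<N. \<forall>j<k. A i j \<in> \<Sigma>) \<and>
     (\<forall>T. T \<subseteq> {..<k} \<and> card T = t \<longrightarrow>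
       (\<forall>x \<in> T \<rightarrow>\<^sub>E \<Sigma>. lam \<le> card {i. i < N \<and> (\<forall>j\<in>T. A i j = x j)}))"

text \<open>Only the size of the alphabet matters, so \<open>{..<v}\<close> serves as the alphabet of size \<open>v\<close>.\<close>

definition CAN :: "nat \<Rightarrow> nat \<Rightarrow> nat \<Rightarrow> nat \<Rightarrow> nat" where
  "CAN lam t k v = (LEAST N. \<exists>A. covering_array {..<v} lam N t k A)"

text \<open>Lower real branch of the Lambert W function; meaningful for \<open>- exp (- 1) \<le> x < 0\<close> only.\<close>

definition Lambert_W_minus1 :: "real \<Rightarrow> real" where
  "Lambert_W_minus1 x = (THE w. w \<le> - 1 \<and> w * exp w = x)"

end

theory Submission
  imports Defs
begin

text \<open>Fill the array uniformly at random, and for a \<open>t\<close>-set \<open>T\<close> of columns let \<open>B T\<close> be the event that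
  some tuple occurs fewer than \<open>\<lambda>\<close> times in \<open>T\<close>.  As \<open>B T\<close> is independent of the events of the
  \<open>t\<close>-sets disjoint from \<open>T\<close>, the symmetric local lemma yields a covering array as soon as
  \<open>e D v\<^sup>t P \<le> 1\<close>, where \<open>D = (k choose t) - ((k - t) choose t)\<close> and \<open>P\<close> is the probability that a
  binomial \<open>(N, p)\<close> variable is less than \<open>\<lambda>\<close>.  Writing \<open>q = 1 - p\<close>, Chernoff's bound gives
  \<open>P \<le> (e N / \<lambda>)\<^sup>\<lambda> q\<^sup>N (p / q)\<^sup>\<lambda>\<close>.  The real number \<open>u\<close> on the right-hand side of the theorem is a
  solution of \<open>(e u / \<lambda>)\<^sup>\<lambda> q\<^sup>u D v\<^sup>t a q e = 1\<close>; since \<open>p \<le> 1/4\<close> makes \<open>(p / q)\<^sup>\<lambda> \<le> a q\<^sup>2\<close>, there is a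
  factor \<open>q\<close> to spare, which pays for rounding \<open>u\<close> down to an integer \<open>N\<close>.\<close>

section \<open>The lower branch of the Lambert function\<close>

text \<open>The derivative \<open>(1 + x) * exp x\<close> is negative for \<open>x < - 1\<close>. It
  vanishes at \<open>- 1\<close>, so its sign is used on the open interval only.\<close>

lemma mult_exp_strict_decreasing:
  fixes u w :: real
  assumes "u < w" "w \<le> - 1"
  shows "w * exp w < u * exp u"
proof (rule DERIV_neg_imp_decreasing_open[OF assms(1)])
  show "\<exists>y. ((\<lambda>w. w * exp w) has_real_derivative y) (at x) \<and> y < 0" if "u < x" "x < w" for x
  proof (intro exI conjI)
    show "((\<lambda>w. w * exp w) has_real_derivative (1 + x) * exp x) (at x)"
      by (auto intro!: derivative_eq_intros simp: algebra_simps)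
    show "(1 + x) * exp x < 0"
      using that assms by (simp add: mult_less_0_iff)
  qed
qed (intro continuous_intros)

lemma Lambert_W_minus1_eqI:
  assumes "w \<le> - 1" "w * exp w = x"
  shows "Lambert_W_minus1 x = w"
  unfolding Lambert_W_minus1_def
proof (rule the_equality)
  show "u = w" if "u \<le> - 1 \<and> u * exp u = x" for u
    using mult_exp_strict_decreasing[of u w] mult_exp_strict_decreasing[of w u] that assms
    by (metis less_irrefl linorder_neqE)
qed (use assms in simp)

text \<open>\<open>c\<close> is a test point: on the left of \<open>- 1\<close> the function
  \<open>w * exp w\<close> decreases from 0 (its limit at minus infinity), so a value
  \<open>x\<close> between \<open>c * exp c\<close> and 0 is attained at some point not above
  \<open>c\<close>.\<close>

lemma Lambert_W_minus1_le:
  assumes "c \<le> - 1" "c * exp c \<le> x" "x < 0"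
  shows "Lambert_W_minus1 x \<le> c"
    and "Lambert_W_minus1 x * exp (Lambert_W_minus1 x) = x"
proof -
  \<comment> \<open>The left end \<open>- s\<close> for the intermediate value theorem: it lies
    below \<open>c\<close>, and \<open>s * exp (- s) \<le> 2 / s \<le> - x\<close> because
    \<open>s\<^sup>2 / 2 \<le> exp s\<close>.\<close>
  define s where "s = max (- c) (2 / (- x))"
  have s: "s \<ge> - c" "s \<ge> 2 / (- x)" "s > 0"
    using assms by (auto simp: s_def)
  have "s * exp (- s) \<le> 2 / s"
  proof -
    have "s\<^sup>2 / 2 \<le> exp s"
      using exp_lower_Taylor_quadratic[of s] s by simp
    then show ?thesis
      using s(3) by (simp add: exp_minus divide_simps power2_eq_square)
  qed
  also have "2 / s \<le> - x"
    using s assms by (simp add: field_simps)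
  finally have "x \<le> (- s) * exp (- s)"
    by simp
  then have "\<exists>w\<ge>- s. w \<le> c \<and> w * exp w = x"
    using s assms by (intro IVT2') (auto intro!: continuous_intros)
  then obtain w where w: "w \<le> c" "w * exp w = x"
    by blast
  then have "Lambert_W_minus1 x = w"
    using assms by (intro Lambert_W_minus1_eqI) auto
  with w show "Lambert_W_minus1 x \<le> c"
    and "Lambert_W_minus1 x * exp (Lambert_W_minus1 x) = x"
    by auto
qed

section \<open>The symmetric local lemma for counting measure\<close>

text \<open>Probabilities are cardinalities, multiplied out by \<open>card \<Omega>\<close>.
  Induction on the size of \<open>S\<close> bounds by \<open>x\<close> the probability of
  \<open>B i\<close> given that no event of \<open>S\<close> occurs; the chain rule then leaves at
  least \<open>(1 - x) ^ card I\<close> of \<open>\<Omega>\<close>. As \<open>\<Gamma> i\<close>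
  contains \<open>i\<close>, there are at most \<open>D - 1\<close> other neighbours, hence the
  exponent.\<close>

lemma lovasz_local_uniform:
  fixes B :: "'i \<Rightarrow> 'b set" and x :: real
  assumes fin: "finite \<Omega>" "\<Omega> \<noteq> {}" "finite I"
    and nbh: "\<And>i. i \<in> I \<Longrightarrow> i \<in> \<Gamma> i" "\<And>i. i \<in> I \<Longrightarrow> \<Gamma> i \<subseteq> I"
      "\<And>i. i \<in> I \<Longrightarrow> card (\<Gamma> i) \<le> D"
    and indep: "\<And>i S. i \<in> I \<Longrightarrow> S \<subseteq> I - \<Gamma> i \<Longrightarrow>
      card \<Omega> * card (B i \<inter> (\<Omega> - \<Union> (B ` S))) \<le> card (B i) * card (\<Omega> - \<Union> (B ` S))"
    and x: "0 \<le> x" "x < 1"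
    and small: "\<And>i. i \<in> I \<Longrightarrow> real (card (B i)) \<le> x * (1 - x) ^ (D - 1) * real (card \<Omega>)"
  shows "\<Omega> - \<Union> (B ` I) \<noteq> {}"
proof -
  define G where "G S = \<Omega> - \<Union> (B ` S)" for S
  have finG: "finite (G S)" for S
    using fin by (simp add: G_def)
  have G_insert: "real (card (G (insert j S))) = real (card (G S)) - real (card (B j \<inter> G S))" for j S
  proof -
    have "G S = G (insert j S) \<union> (B j \<inter> G S)" "G (insert j S) \<inter> (B j \<inter> G S) = {}"
      by (auto simp: G_def)
    then have "card (G S) = card (G (insert j S)) + card (B j \<inter> G S)"
      using card_Un_disjoint[of "G (insert j S)" "B j \<inter> G S"] finG by auto
    then show ?thesis by simp
  qed
  \<comment> \<open>Chain rule: avoiding the events of \<open>R\<close> one after the other costs a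
    factor \<open>1 - x\<close> each. The conditional bound is a premise, so that this serves both
    inside the induction for \<open>cond\<close>, where the bound is known for smaller sets only,
    and after it.\<close>
  have grow: "(1 - x) ^ card R * real (card (G S)) \<le> real (card (G (S \<union> R)))"
    if "finite R" "R \<inter> S = {}"
      and step: "\<And>j R'. j \<in> R \<Longrightarrow> R' \<subseteq> R - {j} \<Longrightarrow>
        real (card (B j \<inter> G (S \<union> R'))) \<le> x * real (card (G (S \<union> R')))"
    for R S
    using that
  proof (induction R rule: finite_induct)
    case empty
    then show ?case by simp
  next
    case (insert j R)
    have IH: "(1 - x) ^ card R * real (card (G S)) \<le> real (card (G (S \<union> R)))"
      using insert.prems by (intro insert.IH) blast+
    have "(1 - x) ^ card (insert j R) * real (card (G S))
        = (1 - x) * ((1 - x) ^ card R * real (card (G S)))"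
      using insert.hyps by simp
    also have "\<dots> \<le> (1 - x) * real (card (G (S \<union> R)))"
      using x by (intro mult_left_mono IH) auto
    also have "\<dots> \<le> real (card (G (insert j (S \<union> R))))"
      using insert.prems(2)[of j R] insert.hyps by (simp add: G_insert algebra_simps)
    finally show ?case by simp
  qed
  have cond: "real (card (B i \<inter> G S)) \<le> x * real (card (G S))" if "i \<in> I" "S \<subseteq> I" for i S
    using that
  proof (induction "card S" arbitrary: i S rule: less_induct)
    case less
    have finS: "finite S"
      using less.prems fin finite_subset by blast
    show ?case
    proof (cases "i \<in> S")
      case True
      then have "B i \<inter> G S = {}"
        by (auto simp: G_def)
      then show ?thesis
        using x by simp
    next
      case False
      \<comment> \<open>Independence from \<open>S2\<close> bounds the numerator of the conditional
        probability, and \<open>grow\<close> applied to the neighbours \<open>S1\<close> bounds the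
        denominator from below. The sets met there leave out some \<open>j\<close> in
        \<open>S1\<close>, so the induction hypothesis covers them.\<close>
      define S1 S2 where "S1 = S \<inter> \<Gamma> i" and "S2 = S - \<Gamma> i"
      have S: "S = S2 \<union> S1" "S1 \<inter> S2 = {}" "finite S1"
        using finS by (auto simp: S1_def S2_def)
      have "S1 \<subseteq> \<Gamma> i - {i}"
        using False by (auto simp: S1_def)
      then have "card S1 \<le> card (\<Gamma> i - {i})"
        using nbh(2)[OF less.prems(1)] fin by (meson card_mono finite_Diff finite_subset)
      also have "\<dots> \<le> D - 1"
        using nbh[OF less.prems(1)] fin(3) by (simp add: card_Diff_singleton)
      finally have S1: "card S1 \<le> D - 1" .
      have "(1 - x) ^ (D - 1) * real (card (G S2)) \<le> (1 - x) ^ card S1 * real (card (G S2))"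
        using x S1 by (intro mult_right_mono power_decreasing) auto
      also have "\<dots> \<le> real (card (G (S2 \<union> S1)))"
      proof (rule grow)
        fix j R' assume j: "j \<in> S1" "R' \<subseteq> S1 - {j}"
        then have "S2 \<union> R' \<subset> S"
          using S by blast
        then show "real (card (B j \<inter> G (S2 \<union> R'))) \<le> x * real (card (G (S2 \<union> R')))"
          using j S less.prems finS by (intro less.hyps psubset_card_mono) auto
      qed (use S in auto)
      finally have lower: "(1 - x) ^ (D - 1) * real (card (G S2)) \<le> real (card (G S))"
        using S by simp
      have "card \<Omega> * card (B i \<inter> G S2) \<le> card (B i) * card (G S2)"
        unfolding G_def using less.prems by (intro indep) (auto simp: S2_def)
      then have "real (card \<Omega>) * real (card (B i \<inter> G S2)) \<le> real (card (B i)) * real (card (G S2))"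
        by (metis of_nat_le_iff of_nat_mult)
      also have "\<dots> \<le> x * (1 - x) ^ (D - 1) * real (card \<Omega>) * real (card (G S2))"
        using small[OF less.prems(1)] by (intro mult_right_mono) auto
      also have "\<dots> = real (card \<Omega>) * (x * ((1 - x) ^ (D - 1) * real (card (G S2))))"
        by simp
      finally have "real (card (B i \<inter> G S2)) \<le> x * ((1 - x) ^ (D - 1) * real (card (G S2)))"
        using fin(1,2) by (simp add: card_gt_0_iff)
      also have "\<dots> \<le> x * real (card (G S))"
        using x lower by (intro mult_left_mono) auto
      finally have "real (card (B i \<inter> G S2)) \<le> x * real (card (G S))" .
      moreover have "card (B i \<inter> G S) \<le> card (B i \<inter> G S2)"
        using finG by (intro card_mono) (auto simp: G_def S2_def)
      ultimately show ?thesis by linarith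
    qed
  qed
  have "0 < (1 - x) ^ card I * real (card (G {}))"
    using x fin by (simp add: G_def card_gt_0_iff)
  also have "\<dots> \<le> real (card (G ({} \<union> I)))"
    using fin by (intro grow cond) auto
  finally have "card (G I) \<noteq> 0"
    by simp
  then show ?thesis
    unfolding G_def by (metis card.empty)
qed

text \<open>The weight \<open>1 / D\<close> works for \<open>D > 1\<close> because
  \<open>(1 - 1 / D) ^ (D - 1)\<close> is the reciprocal of
  \<open>(1 + 1 / (D - 1)) ^ (D - 1) \<le> exp 1\<close>. For \<open>D = 1\<close> it would equal 1,
  so \<open>1 / exp 1\<close> replaces it.\<close>

lemma lovasz_weight_exists:
  fixes D :: nat
  assumes "D \<ge> 1"
  obtains x :: real where "0 \<le> x" "x < 1" "1 / (exp 1 * real D) \<le> x * (1 - x) ^ (D - 1)"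
proof (cases "D = 1")
  case True
  show ?thesis
    by (rule that[of "1 / exp 1"]) (use True in auto)
next
  case False
  define d where "d = D - 1"
  have d: "d \<ge> 1" "real D = real d + 1"
    using assms False by (auto simp: d_def)
  have "(1 + 1 / real d) ^ d \<le> exp 1"
    using exp_ge_one_plus_x_over_n_power_n[of d 1] d by simp
  then have "1 / exp 1 \<le> 1 / (1 + 1 / real d) ^ d"
    by (intro divide_left_mono) (auto simp: add_pos_nonneg)
  also have "\<dots> = (1 / (1 + 1 / real d)) ^ d"
    by (simp add: power_divide)
  also have "1 / (1 + 1 / real d) = 1 - 1 / real D"
    using d by (simp add: field_simps)
  finally have "1 / exp 1 \<le> (1 - 1 / real D) ^ d" .
  then have "1 / real D * (1 / exp 1) \<le> 1 / real D * (1 - 1 / real D) ^ d"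
    by (intro mult_left_mono) auto
  then have "1 / (exp 1 * real D) \<le> 1 / real D * (1 - 1 / real D) ^ (D - 1)"
    by (simp add: d_def mult.commute)
  moreover have "1 / real D < 1"
    using d by simp
  ultimately show ?thesis
    by (intro that[of "1 / real D"]) simp_all
qed

section \<open>Dependency neighbourhoods and independence of disjoint column sets\<close>

text \<open>The \<open>t\<close>-sets that miss \<open>T\<close> are the \<open>t\<close>-subsets of
  the other \<open>k - t\<close> columns. The difference is taken in the reals to match the
  expression in the theorem.\<close>

lemma card_meeting_subsets:
  assumes "T \<subseteq> {..<k}" "card T = t"
  shows "real (card {T'. T' \<subseteq> {..<k} \<and> card T' = t \<and> T' \<inter> T \<noteq> {}})
    = real (k choose t) - real ((k - t) choose t)"
proof -
  define M where "M = {T'. T' \<subseteq> {..<k} \<and> card T' = t \<and> T' \<inter> T \<noteq> {}}"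
  define L where "L = {T'. T' \<subseteq> {..<k} - T \<and> card T' = t}"
  have un: "M \<union> L = {T'. T' \<subseteq> {..<k} \<and> card T' = t}"
    unfolding M_def L_def by blast
  have disj: "M \<inter> L = {}"
    unfolding M_def L_def by blast
  have "finite (M \<union> L)"
    unfolding un by simp
  then have "card (M \<union> L) = card M + card L"
    using disj by (intro card_Un_disjoint) simp_all
  moreover have "card (M \<union> L) = k choose t"
    unfolding un by (simp add: n_subsets)
  moreover have "card L = (k - t) choose t"
    using assms finite_subset[of T "{..<k}"] by (simp add: L_def n_subsets card_Diff_subset)
  ultimately show ?thesis
    unfolding M_def by simp
qed

text \<open>Exchanging the columns in \<open>T\<close> between two arrays is an involution of \<open>\<Omega> \<times> \<Omega>\<close> that maps
  \<open>E \<times> F\<close> into \<open>(E \<inter> F) \<times> \<Omega>\<close> and back.\<close>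

lemma column_events_independent:
  fixes N k :: nat and \<Sigma> :: "'a set"
  defines "\<Omega> \<equiv> {..<N} \<rightarrow>\<^sub>E ({..<k} \<rightarrow>\<^sub>E \<Sigma>)"
  assumes "E \<subseteq> \<Omega>" "F \<subseteq> \<Omega>"
    and E: "\<And>A C. A \<in> E \<Longrightarrow> C \<in> \<Omega> \<Longrightarrow> (\<And>i j. i < N \<Longrightarrow> j < k \<Longrightarrow> j \<in> T \<Longrightarrow> A i j = C i j) \<Longrightarrow> C \<in> E"
    and F: "\<And>A C. A \<in> F \<Longrightarrow> C \<in> \<Omega> \<Longrightarrow> (\<And>i j. i < N \<Longrightarrow> j < k \<Longrightarrow> j \<notin> T \<Longrightarrow> A i j = C i j) \<Longrightarrow> C \<in> F"
  shows "card \<Omega> * card (E \<inter> F) = card E * card F"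
proof -
  define mix :: "(nat \<Rightarrow> nat \<Rightarrow> 'a) \<Rightarrow> (nat \<Rightarrow> nat \<Rightarrow> 'a) \<Rightarrow> nat \<Rightarrow> nat \<Rightarrow> 'a"
    where "mix A C = (\<lambda>i\<in>{..<N}. \<lambda>j\<in>{..<k}. if j \<in> T then A i j else C i j)" for A C
  have mixO: "mix A C \<in> \<Omega>" if "A \<in> \<Omega>" "C \<in> \<Omega>" for A C
    using that unfolding \<Omega>_def mix_def by (auto simp: PiE_iff)
  have mix_inv: "mix (mix A C) (mix C A) = A" if "A \<in> \<Omega>" for A C
    using that unfolding \<Omega>_def
    by (intro ext) (auto simp: mix_def PiE_iff extensional_def restrict_def)
  have mixE: "mix A C \<in> E" if "A \<in> E" "C \<in> \<Omega>" for A C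
    by (rule E[OF that(1)]) (use that assms(2) mixO in \<open>auto simp: mix_def\<close>)
  have mixF: "mix A C \<in> F" if "A \<in> \<Omega>" "C \<in> F" for A C
    by (rule F[OF that(2)]) (use that assms(3) mixO in \<open>auto simp: mix_def\<close>)
  let ?\<sigma> = "\<lambda>(A, C). (mix A C, mix C A)"
  have "bij_betw ?\<sigma> (E \<times> F) ((E \<inter> F) \<times> \<Omega>)"
  proof (rule bij_betw_byWitness[where f' = ?\<sigma>])
    show "\<forall>a\<in>E \<times> F. ?\<sigma> (?\<sigma> a) = a" "\<forall>a\<in>(E \<inter> F) \<times> \<Omega>. ?\<sigma> (?\<sigma> a) = a"
      using assms(2,3) mix_inv by auto
    show "?\<sigma> ` (E \<times> F) \<subseteq> (E \<inter> F) \<times> \<Omega>"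
      using assms(2,3) by (auto intro: mixE mixF mixO)
    show "?\<sigma> ` ((E \<inter> F) \<times> \<Omega>) \<subseteq> E \<times> F"
      using assms(2,3) by (auto intro: mixE mixF)
  qed
  then show ?thesis
    using bij_betw_same_card by (fastforce simp: card_cartesian_product)
qed

section \<open>Chernoff's bound for the number of occurrences of a tuple\<close>

text \<open>Markov's inequality for \<open>z ^ X\<close>, where \<open>X\<close> counts the rows
  that show \<open>x\<close>: as \<open>z \<le> 1\<close>, \<open>X < lam\<close> forces
  \<open>z ^ X \<ge> z ^ lam\<close>. The sum of \<open>z ^ X\<close> over all arrays factors into
  one sum per row, each equal to \<open>(1 - p + p * z) * v ^ k\<close>.\<close>

lemma card_few_occurrences:
  fixes p z :: real and N k v :: nat
  assumes T: "T \<subseteq> {..<k}" and x: "x \<in> T \<rightarrow>\<^sub>E {..<v}" and "v \<ge> 1"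
    and p: "p = 1 / real v ^ card T" and z: "0 < z" "z \<le> 1"
  defines "\<Omega> \<equiv> {..<N} \<rightarrow>\<^sub>E ({..<k} \<rightarrow>\<^sub>E {..<v})"
  shows "real (card {A \<in> \<Omega>. card {i. i < N \<and> (\<forall>j\<in>T. A i j = x j)} < lam}) * z ^ lam
    \<le> (1 - p + p * z) ^ N * real (card \<Omega>)"
proof -
  define R where "R = {..<k} \<rightarrow>\<^sub>E {..<v}"
  define hit where "hit r \<longleftrightarrow> (\<forall>j\<in>T. r j = x j)" for r :: "nat \<Rightarrow> nat"
  define f where "f r = (if hit r then z else 1)" for r
  have finR: "finite R" and fin\<Omega>: "finite \<Omega>"
    by (simp_all add: R_def \<Omega>_def finite_PiE)
  have cardR: "card R = v ^ k"
    by (simp add: R_def card_PiE)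
  have finT: "finite T" and cT: "card T \<le> k"
    using T finite_subset[of T "{..<k}"] card_mono[of "{..<k}" T] by auto
  have "{r \<in> R. hit r} = (\<Pi>\<^sub>E j\<in>{..<k}. if j \<in> T then {x j} else {..<v})"
    using T x unfolding R_def hit_def by (fastforce simp: PiE_iff split: if_splits)
  then have "card {r \<in> R. hit r} = (\<Prod>j<k. if j \<in> T then 1 else v)"
    by (simp add: card_PiE if_distrib cong: if_cong)
  also have "\<dots> = v ^ card ({..<k} - T)"
    by (simp add: prod.If_cases Diff_eq)
  finally have hits: "card {r \<in> R. hit r} = v ^ (k - card T)"
    using T finT by (simp add: card_Diff_subset)
  have vk: "real v ^ (k - card T) = p * real v ^ k"
    using cT \<open>v \<ge> 1\<close> by (simp add: p power_diff)
  have "(\<Sum>r\<in>R. f r) = (\<Sum>r\<in>R. 1 - (1 - z) * (if hit r then 1 else 0))"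
    by (intro sum.cong) (auto simp: f_def)
  also have "\<dots> = real (card R) - (1 - z) * real (card {r \<in> R. hit r})"
    using finR by (simp add: sum_subtractf sum.If_cases Int_def conj_commute flip: sum_distrib_left)
  also have "\<dots> = (1 - p + p * z) * real v ^ k"
    by (simp add: hits cardR vk algebra_simps)
  finally have sum_f: "(\<Sum>r\<in>R. f r) = (1 - p + p * z) * real v ^ k" .
  have weight: "(\<Prod>i<N. f (A i)) = z ^ card {i. i < N \<and> hit (A i)}" for A
    by (simp add: f_def prod.If_cases Int_def)
  have "real (card {A \<in> \<Omega>. card {i. i < N \<and> hit (A i)} < lam}) * z ^ lam
      = (\<Sum>A | A \<in> \<Omega> \<and> card {i. i < N \<and> hit (A i)} < lam. z ^ lam)"
    by simp
  also have "\<dots> \<le> (\<Sum>A | A \<in> \<Omega> \<and> card {i. i < N \<and> hit (A i)} < lam. \<Prod>i<N. f (A i))"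
    unfolding weight using z by (intro sum_mono power_decreasing) auto
  also have "\<dots> \<le> (\<Sum>A\<in>\<Omega>. \<Prod>i<N. f (A i))"
    unfolding weight using z fin\<Omega> by (intro sum_mono2) auto
  also have "\<dots> = (\<Prod>i<N. \<Sum>r\<in>R. f r)"
    unfolding \<Omega>_def R_def[symmetric] using finR by (intro prod_sum_PiE[symmetric]) auto
  also have "\<dots> = (1 - p + p * z) ^ N * real (card \<Omega>)"
    by (simp add: sum_f \<Omega>_def card_PiE power_mult_distrib)
  finally show ?thesis
    unfolding hit_def .
qed

text \<open>For \<open>lam < N\<close> the left side is smallest at
  \<open>z = (1 - p) * lam / ((N - lam) * p)\<close>. Putting \<open>N\<close> for
  \<open>N - lam\<close> gives \<open>1 - p + p * z = (1 - p) * (1 + lam / N)\<close>, whose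
  \<open>N\<close>-th power is at most \<open>(1 - p) ^ N * exp lam\<close>.\<close>

lemma chernoff_weight:
  fixes p z :: real and N lam :: nat
  assumes p: "0 < p" "p < 1" and "lam \<ge> 1" "N \<ge> 1"
  defines "z \<equiv> (1 - p) * real lam / (real N * p)"
  shows "(1 - p + p * z) ^ N / z ^ lam
    \<le> (exp 1 * real N / real lam) ^ lam * (1 - p) ^ N * (p / (1 - p)) ^ lam"
proof -
  define q where "q = 1 - p"
  have q: "q > 0" using p by (simp add: q_def)
  have z: "z > 0" "q + p * z = q * (1 + real lam / real N)"
    using assms q by (simp_all add: z_def q_def field_simps)
  have "(1 + real lam / real N) ^ N \<le> exp (real lam)"
    using exp_ge_one_plus_x_over_n_power_n[of N "real lam"] assms by simp
  then have "(q + p * z) ^ N \<le> q ^ N * exp (real lam)"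
    unfolding z using q by (simp add: power_mult_distrib)
  then have "(q + p * z) ^ N / z ^ lam \<le> q ^ N * exp (real lam) / z ^ lam"
    using z by (intro divide_right_mono) auto
  also have "\<dots> = q ^ N * (exp 1 / z) ^ lam"
    by (simp add: power_divide exp_of_nat_mult[symmetric])
  also have "exp 1 / z = exp 1 * real N / real lam * (p / q)"
    using q p assms by (simp add: z_def q_def field_simps)
  also have "(exp 1 * real N / real lam * (p / q)) ^ lam
      = (exp 1 * real N / real lam) ^ lam * (p / q) ^ lam"
    by (rule power_mult_distrib)
  finally show ?thesis
    by (simp add: mult_ac flip: q_def)
qed

section \<open>Numerical estimates and the choice of the number of rows\<close>

lemma neg_ln_one_minus_le:
  fixes p :: real
  assumes "0 < p" "p < 1"
  shows "- ln (1 - p) \<le> p / (1 - p)"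
proof -
  have "ln (1 / (1 - p)) \<le> 1 / (1 - p) - 1"
    using assms by (intro ln_le_minus_one) auto
  then show ?thesis
    using assms by (simp add: ln_div field_simps)
qed

text \<open>With \<open>q = 1 - p\<close> the denominator is \<open>q\<^sup>2 - p\<^sup>2\<close>,
  so the quotient is a geometric sum with leading term \<open>q ^ (2 * (n - 1))\<close>; the other
  terms are nonnegative.\<close>

lemma sqrt_power_diff_ge:
  fixes p :: real
  assumes "0 \<le> p" "p < 1 / 2" "n \<ge> 1"
  shows "(1 - p) ^ (n - 1) \<le> sqrt (((1 - p) ^ (2 * n) - p ^ (2 * n)) / (1 - 2 * p))"
proof -
  obtain m where m: "n = Suc m"
    using assms by (cases n) auto
  have "p ^ (2 * m) \<le> (1 - p) ^ (2 * m)"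
    using assms by (intro power_mono) auto
  then have "p\<^sup>2 * p ^ (2 * m) \<le> p\<^sup>2 * (1 - p) ^ (2 * m)"
    by (intro mult_left_mono) auto
  moreover have "((1 - p) ^ m)\<^sup>2 = (1 - p) ^ (2 * m)"
    by (simp flip: power_mult add: mult.commute)
  moreover have "(1 - p) ^ (2 * n) = (1 - p)\<^sup>2 * (1 - p) ^ (2 * m)" "p ^ (2 * n) = p\<^sup>2 * p ^ (2 * m)"
    by (simp_all add: m flip: power_add)
  moreover have "(1 - p)\<^sup>2 = 1 - 2 * p + p\<^sup>2"
    by (simp add: power2_eq_square algebra_simps)
  ultimately have "((1 - p) ^ m)\<^sup>2 * (1 - 2 * p) \<le> (1 - p) ^ (2 * n) - p ^ (2 * n)"
    by (simp add: algebra_simps)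
  then show ?thesis
    using assms by (intro real_le_rsqrt) (simp add: m pos_le_divide_eq)
qed

text \<open>\<open>C\<close> stands for the number of neighbours times the number of tuples. The
  crux is that the Lambert value is at most \<open>- 2\<close>, not just \<open>- 1\<close>: this
  makes \<open>u\<close> so large that even after rounding down the Chernoff weight \<open>z\<close>
  does not exceed 1.\<close>

lemma Lambert_array_size:
  fixes p a C :: real and lam :: nat
  assumes p: "0 < p" "p \<le> 1 / 4" and lam: "lam \<ge> 1"
    and a: "(1 - p) ^ (lam - 1) \<le> a" and C: "C \<ge> 1"
  defines "u \<equiv> real lam / ln (1 - p) *
    Lambert_W_minus1 (ln (1 - p) / (exp 1 * (C * a * (1 - p) * exp 1) powr (1 / real lam)))"
  obtains N :: nat and z :: real where "real N \<le> u" "0 < z" "z \<le> 1"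
    "C * ((1 - p + p * z) ^ N / z ^ lam) \<le> 1 / exp 1"
proof -
  define q where "q = 1 - p"
  define L where "L = ln q"
  define c where "c = C * a * q * exp 1"
  define M where "M = c powr (1 / real lam)"
  define w where "w = Lambert_W_minus1 (L / (exp 1 * M))"
  have q: "3 / 4 \<le> q" "q < 1" "0 < q"
    using p by (auto simp: q_def)
  have L: "L < 0" "- L \<le> p / q"
    using q p neg_ln_one_minus_le[of p] by (auto simp: L_def q_def)
  have q2: "9 / 16 \<le> q\<^sup>2" "27 / 64 \<le> q ^ 3"
    using power_mono[OF q(1), of 2] power_mono[OF q(1), of 3] by (auto simp: power_divide)
  have u: "u = real lam / L * w"
    by (simp add: u_def w_def L_def M_def c_def q_def)
  have a': "q ^ (lam - 1) \<le> a" "0 < a"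
    using a q zero_less_power[of q "lam - 1"] unfolding q_def by linarith+
  \<comment> \<open>\<open>c \<ge> q ^ lam\<close> yields \<open>M \<ge> q\<close>, which keeps the
    argument of the Lambert function from being too negative.\<close>
  have "q ^ lam = q ^ (lam - 1) * q"
    using lam by (cases lam) auto
  also have "\<dots> \<le> (C * a) * q"
    using a' C q mult_mono[of 1 C "q ^ (lam - 1)" a] by (intro mult_right_mono) auto
  also have "\<dots> \<le> c"
    using C a' q exp_ge_add_one_self[of 1] mult_left_mono[of 1 "exp 1" "C * a * q"]
    by (auto simp: c_def)
  finally have c: "q ^ lam \<le> c" "c > 0"
    using q zero_less_power[of q lam] by linarith+
  have M_pow: "M ^ lam = c" and "M > 0"
    using c lam by (auto simp: M_def powr_powr simp flip: powr_realpow)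
  have "q \<le> M"
    using c M_pow \<open>M > 0\<close> q lam by (metis power_le_imp_le_base less_eq_real_def Suc_diff_1 less_le_trans zero_less_one)
  have y_neg: "L / (exp 1 * M) < 0"
    using L \<open>M > 0\<close> by (simp add: divide_neg_pos)
  \<comment> \<open>Amounts to \<open>- 2 * exp (- 2) \<le> L / (exp 1 * M)\<close>, the premise for
    the test point \<open>- 2\<close>. Here \<open>p \<le> 1 / 4\<close> and
    \<open>q\<^sup>2 \<ge> 9 / 16\<close> give \<open>4 / 9\<close>, and
    \<open>exp 1 \<le> 3\<close> gives the rest.\<close>
  have "- L / M \<le> (p / q) / q"
    using L q p \<open>q \<le> M\<close> by (intro frac_le) auto
  also have "\<dots> \<le> 4 / 9"
    using q2 p q by (simp add: divide_simps power2_eq_square)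
  also have "\<dots> \<le> 2 / exp 1"
    using exp_le by (simp add: divide_simps)
  finally have "- L / M * exp (- 1) \<le> 2 / exp 1 * exp (- 1)"
    by (intro mult_right_mono) auto
  then have "- 2 * exp (- 2) \<le> L / (exp 1 * M)"
    by (simp add: exp_minus field_simps flip: exp_add)
  then have w: "w \<le> - 2" "w * exp w = L / (exp 1 * M)"
    unfolding w_def using y_neg by (intro Lambert_W_minus1_le[of "- 2"]; simp)+
  \<comment> \<open>Substituting \<open>w = u * L / lam\<close> into the Lambert equation; the
    \<open>lam\<close>-th power of the result is the defining equation \<open>key\<close> of
    \<open>u\<close>.\<close>
  have "u / real lam * exp (u / real lam * L) * (exp 1 * M) = 1"
  proof -
    have 1: "u / real lam = w / L"
      using u lam by simp
    then have "u / real lam * exp (u / real lam * L) * (exp 1 * M) = w * exp w * (exp 1 * M) / L"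
      using L by simp
    also have "\<dots> = 1"
      unfolding w(2) using L \<open>M > 0\<close> by simp
    finally show ?thesis .
  qed
  then have "(exp 1 * u / real lam * exp (u / real lam * L) * M) ^ lam = 1"
    by (simp add: mult_ac)
  then have "(exp 1 * u / real lam) ^ lam * exp (u / real lam * L) ^ lam * c = 1"
    unfolding power_mult_distrib[of _ M] power_mult_distrib[of _ "exp (u / real lam * L)"] M_pow .
  moreover have "exp (u / real lam * L) ^ lam = q powr u"
    using lam q by (simp add: powr_def L_def flip: exp_of_nat_mult)
  ultimately have key: "(exp 1 * u / real lam) ^ lam * q powr u * c = 1"
    by simp
  \<comment> \<open>The Chernoff weight \<open>z\<close> below is at most \<open>1\<close> exactly when \<open>N \<ge> K\<close>.\<close>
  define K where "K = real lam * q / p"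
  \<comment> \<open>\<open>w \<le> - 2\<close> and \<open>- L \<le> p / q\<close> give
    \<open>u \<ge> 2 * K\<close>; since \<open>K \<ge> 1\<close>, one copy of \<open>K\<close> pays
    for the rounding.\<close>
  have lower: "K \<le> u - 1"
  proof -
    have "1 \<le> K"
      using lam q p mult_mono[of 1 "real lam" p q] by (simp add: K_def pos_le_divide_eq)
    moreover have "2 * K \<le> u"
    proof -
      have "q / p \<le> 1 / (- L)"
        using L p q by (simp add: divide_simps mult.commute)
      then have "real lam * (q / p) * 2 \<le> real lam * (1 / - L) * (- w)"
        using w lam q p L by (intro mult_mono) (auto simp: divide_nonneg_neg)
      then show ?thesis
        by (simp add: u K_def mult_ac)
    qed
    ultimately show ?thesis by linarith
  qed
  have "0 < K"
    using lam q p by (simp add: K_def)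
  with lower have "u > 1" by linarith
  define N where "N = nat \<lfloor>u\<rfloor>"
  have N: "real N \<le> u" "u - 1 \<le> real N" "N \<ge> 1"
    using \<open>u > 1\<close> unfolding N_def by linarith+
  define z where "z = q * real lam / (real N * p)"
  have "K \<le> real N"
    using lower N by linarith
  then have z: "0 < z" "z \<le> 1"
    using N lam p q by (auto simp: z_def K_def field_simps)
  \<comment> \<open>The factor \<open>1 / q\<close> lost by rounding down is absorbed by \<open>p / q \<le> q\<^sup>2\<close>.\<close>
  have decay: "q ^ N * (p / q) ^ lam \<le> q powr u * (a * q)"
  proof -
    have "q ^ N = q powr real N"
      using q by (simp add: powr_realpow)
    also have "\<dots> \<le> q powr (u - 1)"
      using q N by (intro powr_mono') auto
    also have "\<dots> = q powr u / q"
      using q by (simp add: powr_diff)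
    finally have 1: "q ^ N \<le> q powr u / q" .
    obtain m where m: "lam = Suc m"
      using lam by (cases lam) auto
    \<comment> \<open>One factor \<open>p / q\<close> is bounded by \<open>q\<^sup>2\<close>, as
      \<open>p \<le> 1 / 4 \<le> 27 / 64 \<le> q ^ 3\<close>; the other \<open>m\<close> factors are
      bounded by \<open>q\<close>, and \<open>q ^ m \<le> a\<close>.\<close>
    have "(p / q) ^ m \<le> q ^ m"
      using p q q2 by (intro power_mono) (auto simp: divide_simps power2_eq_square)
    moreover have "p / q \<le> q\<^sup>2"
      using p q q2 by (simp add: divide_simps power2_eq_square power3_eq_cube)
    ultimately have "(p / q) ^ lam \<le> q\<^sup>2 * q ^ m"
      unfolding m power_Suc using p q by (intro mult_mono) auto
    also have "\<dots> \<le> q\<^sup>2 * a"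
      using a' q by (intro mult_left_mono) (auto simp: m)
    finally have "q ^ N * (p / q) ^ lam \<le> (q powr u / q) * (q\<^sup>2 * a)"
      using 1 p q by (intro mult_mono) auto
    then show ?thesis
      using q by (simp add: power2_eq_square mult_ac)
  qed
  have "(q + p * z) ^ N / z ^ lam \<le> (exp 1 * real N / real lam) ^ lam * (q ^ N * (p / q) ^ lam)"
    using chernoff_weight[of p lam N] p lam N by (simp add: q_def z_def mult_ac)
  also have "\<dots> \<le> (exp 1 * u / real lam) ^ lam * (q powr u * (a * q))"
    using N p q by (intro mult_mono[OF _ decay] power_mono divide_right_mono) auto
  finally have "C * ((q + p * z) ^ N / z ^ lam) \<le> C * \<dots>"
    using C by (intro mult_left_mono) auto
  also have "\<dots> = 1 / exp 1"
    using key by (simp add: c_def eq_divide_eq mult_ac)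
  finally show ?thesis
    using that[of N z] N z by (simp add: q_def)
qed

section \<open>Covering arrays from the local lemma\<close>

text \<open>A union bound over the \<open>v ^ t\<close> tuples and
  \<open>card_few_occurrences\<close> bound each bad event, and \<open>bound\<close> is then the
  condition of the local lemma. Keeping \<open>z\<close> free separates this from the optimisation
  of \<open>z\<close> and \<open>N\<close>.\<close>

lemma covering_array_exists:
  fixes p z :: real and N t k v lam :: nat
  assumes "1 \<le> t" "t \<le> k" "1 \<le> v" and p: "p = 1 / real v ^ t" and z: "0 < z" "z \<le> 1"
    and bound: "(real (k choose t) - real ((k - t) choose t)) * real v ^ t *
      ((1 - p + p * z) ^ N / z ^ lam) \<le> 1 / exp 1"
  shows "\<exists>A. covering_array {..<v} lam N t k A"
proof -
  define \<Omega> where "\<Omega> = {..<N} \<rightarrow>\<^sub>E ({..<k} \<rightarrow>\<^sub>E {..<v})"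
  define I where "I = {T. T \<subseteq> {..<k} \<and> card T = t}"
  define few where "few T x = {A \<in> \<Omega>. card {i. i < N \<and> (\<forall>j\<in>T. A i j = x j)} < lam}"
    for T and x :: "nat \<Rightarrow> nat"
  define B where "B T = (\<Union>x\<in>T \<rightarrow>\<^sub>E {..<v}. few T x)" for T
  define \<Gamma> where "\<Gamma> T = {T'. T' \<subseteq> {..<k} \<and> card T' = t \<and> T' \<inter> T \<noteq> {}}" for T
  \<comment> \<open>A natural number is wanted for the local lemma; \<open>{..<t}\<close> is a
    sample set, and every \<open>T\<close> in \<open>I\<close> has as many neighbours.\<close>
  define D where "D = card (\<Gamma> {..<t})"
  have "finite I"
    by (simp add: I_def)
  have fin\<Omega>: "finite \<Omega>"
    by (simp add: \<Omega>_def finite_PiE)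
  have "\<Omega> \<noteq> {}"
    using \<open>1 \<le> v\<close> by (simp add: \<Omega>_def PiE_eq_empty_iff lessThan_empty_iff)
  have D: "real D = real (k choose t) - real ((k - t) choose t)"
    unfolding D_def \<Gamma>_def using \<open>t \<le> k\<close> by (intro card_meeting_subsets) auto
  have card_\<Gamma>: "card (\<Gamma> T) = D" if "T \<in> I" for T
    using that card_meeting_subsets[of T k t] D by (simp add: I_def \<Gamma>_def)
  have self: "T \<in> \<Gamma> T" if "T \<in> I" for T
    using that \<open>1 \<le> t\<close> by (auto simp: I_def \<Gamma>_def)
  have \<Gamma>I: "\<Gamma> T \<subseteq> I" for T
    by (auto simp: I_def \<Gamma>_def)
  have "{..<t} \<in> \<Gamma> {..<t}"
    using \<open>t \<le> k\<close> by (intro self) (auto simp: I_def)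
  moreover have "finite (\<Gamma> {..<t})"
    using \<Gamma>I \<open>finite I\<close> by (rule finite_subset)
  ultimately have "D \<ge> 1"
    unfolding D_def by (metis One_nat_def Suc_leI card_gt_0_iff empty_iff)
  then obtain \<xi> :: real where \<xi>: "0 \<le> \<xi>" "\<xi> < 1" "1 / (exp 1 * real D) \<le> \<xi> * (1 - \<xi>) ^ (D - 1)"
    by (rule lovasz_weight_exists)
  \<comment> \<open>\<open>B T\<close> depends on the columns in \<open>T\<close> only; both
    invariance premises of \<open>column_events_independent\<close> rest on this.\<close>
  have cong: "C \<in> B T" if "A \<in> B T" "C \<in> \<Omega>" "T \<in> I" "\<And>i j. i < N \<Longrightarrow> j \<in> T \<Longrightarrow> A i j = C i j" for A C T
  proof -
    have "{i. i < N \<and> (\<forall>j\<in>T. C i j = x j)} = {i. i < N \<and> (\<forall>j\<in>T. A i j = x j)}" for x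
      using that(4) by auto
    then show ?thesis
      using that(1,2) by (auto simp: B_def few_def)
  qed
  have "\<Omega> - \<Union> (B ` I) \<noteq> {}"
  proof (rule lovasz_local_uniform[where D = D and x = \<xi> and \<Gamma> = \<Gamma>])
    fix T assume T: "T \<in> I"
    show "T \<in> \<Gamma> T" "\<Gamma> T \<subseteq> I" "card (\<Gamma> T) \<le> D"
      using self \<Gamma>I card_\<Gamma> T by auto
    have cardT: "T \<subseteq> {..<k}" "card T = t" "finite T"
      using T finite_subset[of T "{..<k}"] by (auto simp: I_def)
    \<comment> \<open>The sets in \<open>S\<close> are disjoint from \<open>T\<close>, so avoiding
      their events is decided by the columns outside \<open>T\<close>, while \<open>B T\<close> is
      decided by those inside.\<close>
    show "card \<Omega> * card (B T \<inter> (\<Omega> - \<Union> (B ` S))) \<le> card (B T) * card (\<Omega> - \<Union> (B ` S))"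
      if S: "S \<subseteq> I - \<Gamma> T" for S
      unfolding \<Omega>_def
    proof (rule eq_refl, rule column_events_independent[where T = T], unfold \<Omega>_def[symmetric])
      show "B T \<subseteq> \<Omega>"
        by (auto simp: B_def few_def)
      show "C \<in> B T"
        if "A \<in> B T" "C \<in> \<Omega>" "\<And>i j. i < N \<Longrightarrow> j < k \<Longrightarrow> j \<in> T \<Longrightarrow> A i j = C i j" for A C
        using that cardT T by (intro cong[of A T C]) auto
      show "C \<in> \<Omega> - \<Union> (B ` S)"
        if A: "A \<in> \<Omega> - \<Union> (B ` S)" and C: "C \<in> \<Omega>"
          and eq: "\<And>i j. i < N \<Longrightarrow> j < k \<Longrightarrow> j \<notin> T \<Longrightarrow> A i j = C i j" for A C
      proof -
        have "C \<notin> B T'" if "T' \<in> S" for T'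
        proof
          assume "C \<in> B T'"
          moreover have "T' \<in> I" "T' \<subseteq> {..<k}" "T' \<inter> T = {}"
            using that S by (auto simp: I_def \<Gamma>_def)
          ultimately have "A \<in> B T'"
            using A eq by (intro cong[of C T' A]) (auto simp: disjoint_iff subset_iff)
          then show False
            using A that by blast
        qed
        with C show ?thesis by blast
      qed
    qed auto
    have "real (card (B T)) \<le> (\<Sum>x\<in>T \<rightarrow>\<^sub>E {..<v}. real (card (few T x)))"
    proof -
      have "card (B T) \<le> (\<Sum>x\<in>T \<rightarrow>\<^sub>E {..<v}. card (few T x))"
        unfolding B_def using cardT by (intro card_UN_le finite_PiE) auto
      then show ?thesis
        by (simp flip: of_nat_sum)
    qed
    also have "\<dots> \<le> (\<Sum>x\<in>T \<rightarrow>\<^sub>E {..<v}. (1 - p + p * z) ^ N / z ^ lam * real (card \<Omega>))"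
    proof (rule sum_mono)
      fix x assume x: "x \<in> T \<rightarrow>\<^sub>E {..<v}"
      have "real (card (few T x)) * z ^ lam \<le> (1 - p + p * z) ^ N * real (card \<Omega>)"
        unfolding few_def \<Omega>_def
        using cardT x \<open>1 \<le> v\<close> p z by (intro card_few_occurrences) auto
      then show "real (card (few T x)) \<le> (1 - p + p * z) ^ N / z ^ lam * real (card \<Omega>)"
        using z by (simp add: field_simps)
    qed
    also have "\<dots> = real v ^ t * ((1 - p + p * z) ^ N / z ^ lam) * real (card \<Omega>)"
      using cardT by (simp add: card_PiE)
    also have "\<dots> \<le> \<xi> * (1 - \<xi>) ^ (D - 1) * real (card \<Omega>)"
    proof (rule mult_right_mono)
      have "real v ^ t * ((1 - p + p * z) ^ N / z ^ lam) \<le> 1 / (exp 1 * real D)"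
        using bound \<open>D \<ge> 1\<close> unfolding D[symmetric]
        by (simp add: pos_le_divide_eq mult_ac)
      then show "real v ^ t * ((1 - p + p * z) ^ N / z ^ lam) \<le> \<xi> * (1 - \<xi>) ^ (D - 1)"
        using \<xi>(3) by linarith
    qed auto
    finally show "real (card (B T)) \<le> \<xi> * (1 - \<xi>) ^ (D - 1) * real (card \<Omega>)" .
  qed (use fin\<Omega> \<open>\<Omega> \<noteq> {}\<close> \<open>finite I\<close> \<xi> in auto)
  then obtain A where A: "A \<in> \<Omega>" "\<And>T. T \<in> I \<Longrightarrow> A \<notin> B T"
    by blast
  have "covering_array {..<v} lam N t k A"
    unfolding covering_array_def
  proof (intro conjI allI impI ballI)
    show "A i j \<in> {..<v}" if "i < N" "j < k" for i j
      using A(1) that by (auto simp: \<Omega>_def PiE_iff)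
    show "lam \<le> card {i. i < N \<and> (\<forall>j\<in>T. A i j = x j)}"
      if "T \<subseteq> {..<k} \<and> card T = t" "x \<in> T \<rightarrow>\<^sub>E {..<v}" for T x
      using A(1) A(2)[of T] that by (force simp: I_def B_def few_def not_less)
  qed
  then show ?thesis by blast
qed

theorem theorem5p2:
  fixes t k v lam :: nat and p a :: real
  assumes "lam \<ge> 1" and "t \<ge> 2" and "k \<ge> t" and "v \<ge> 2"
    and "p = 1 / real v ^ t"
    and "a = sqrt (((1 - p) ^ (2 * lam) - p ^ (2 * lam)) / (1 - 2 * p))"
  shows "real (CAN lam t k v) \<le>
    real lam / ln (1 - p) *
      Lambert_W_minus1
        (ln (1 - p) /
          (exp 1 *
            ((real (k choose t) - real ((k - t) choose t)) * real v ^ t * a * (1 - p) * exp 1)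
              powr (1 / real lam)))"
proof -
  define C where "C = (real (k choose t) - real ((k - t) choose t)) * real v ^ t"
  \<comment> \<open>\<open>t \<ge> 2\<close> and \<open>v \<ge> 2\<close> give the bound
    \<open>p \<le> 1 / 4\<close> on which the numerical estimates rest.\<close>
  have "(2::real) ^ 2 \<le> 2 ^ t"
    using \<open>t \<ge> 2\<close> by (intro power_increasing) auto
  also have "\<dots> \<le> real v ^ t"
    using \<open>v \<ge> 2\<close> by (intro power_mono) auto
  finally have vt: "4 \<le> real v ^ t"
    by simp
  then have p: "0 < p" "p \<le> 1 / 4"
    unfolding assms(5) using le_imp_inverse_le[OF vt] \<open>v \<ge> 2\<close>
    by (auto simp: inverse_eq_divide)
  have a: "(1 - p) ^ (lam - 1) \<le> a"
    unfolding assms(6) using p \<open>lam \<ge> 1\<close> by (intro sqrt_power_diff_ge) auto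
  \<comment> \<open>A nonempty set meets itself, so the neighbourhood size is at least 1 and
    \<open>C \<ge> 1\<close> follows.\<close>
  have "{..<t} \<in> {T'. T' \<subseteq> {..<k} \<and> card T' = t \<and> T' \<inter> {..<t} \<noteq> {}}" (is "_ \<in> ?M")
    using \<open>t \<ge> 2\<close> \<open>k \<ge> t\<close> by (auto simp: lessThan_empty_iff)
  moreover have "finite ?M"
    by simp
  ultimately have "card ?M > 0"
    unfolding card_gt_0_iff by blast
  then have "1 \<le> real (k choose t) - real ((k - t) choose t)"
    using card_meeting_subsets[of "{..<t}" k t] \<open>k \<ge> t\<close> by simp
  then have C: "C \<ge> 1"
    unfolding C_def using vt mult_mono[of 1 _ 1 "real v ^ t"] by fastforce
  obtain N :: nat and z :: real where N: "real N \<le> real lam / ln (1 - p) *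
      Lambert_W_minus1 (ln (1 - p) / (exp 1 * (C * a * (1 - p) * exp 1) powr (1 / real lam)))"
    and z: "0 < z" "z \<le> 1" "C * ((1 - p + p * z) ^ N / z ^ lam) \<le> 1 / exp 1"
    using Lambert_array_size[OF p \<open>lam \<ge> 1\<close> a C] by blast
  have "\<exists>A. covering_array {..<v} lam N t k A"
    using assms z by (intro covering_array_exists[of t k v p z]) (auto simp: C_def)
  then have "CAN lam t k v \<le> N"
    unfolding CAN_def by (rule Least_le)
  then have "real (CAN lam t k v) \<le> real N"
    by simp
  also note N
  finally show ?thesis
    by (simp only: C_def)
qed

end
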